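(* Let $\mathcal{S}$ be a numerical semigroup. If $m=\min(\mathcal{S}\setminus\{0\})$, then $\mathcal{S}$ is an $(m-1)$-quotient. In particular, if $\mathsf{e}(\mathcal{S})=m$, then $\mathcal{S}$ does not have full quotient rank.
   Context: Here $\mathbb{N}=\{0,1,2,\dots\}$. A numerical semigroup is a subset of $\mathbb{N}$ containing $0$ and closed under addition (finite complement in $\mathbb{N}$ is not required). $\langle g_1,\dots,g_n\rangle=\{g_1x_1+\cdots+g_nx_n: x_i\in\mathbb{N}\}$. The embedding dimension $\mathsf{e}(\mathcal{S})$ is the number of elements of the minimal generating set of $\mathcal{S}$. For a numerical semigroup $\mathcal{T}$ and a positive integer $d$, $\frac{\mathcal{T}}{d}=\{t\in\mathbb{N}: dt\in\mathcal{T}\}$. A numerical semigroup is a $k$-quotient if it equals $\frac{\langle c_1,\dots,c_k\rangle}{d}$ for some positive integers $d,c_1,\dots,c_k$. The quotient rank of $\mathcal{S}$ is the smallest $k$ such that $\mathcal{S}$ is a $k$-quotient; it is at most $\mathsf{e}(\mathcal{S})$, since $\mathcal{S}=\frac{\mathcal{S}}{1}$. $\mathcal{S}$ has full quotient rank if its quotient rank equals $\mathsf{e}(\mathcal{S})$.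
   Formalization: The statement fails for m = 1 (S = ℕ) and for m = 2 unless S = ⟨2⟩ (e.g. ⟨2,3⟩ is not a 1-quotient and has full quotient rank), so it is assumed that m ≥ 3 or S = ⟨2⟩; S ≠ {0} is also assumed so that m exists. *)

theory Defs
  imports Main
begin

definition numerical_semigroup :: "nat set \<Rightarrow> bool" where
  "numerical_semigroup S \<longleftrightarrow> 0 \<in> S \<and> (\<forall>x\<in>S. \<forall>y\<in>S. x + y \<in> S)"

text \<open>
  For a finite index set \<open>I\<close>, the set of all combinations with coefficients in the natural
  numbers of the family \<open>(g i)\<close>, \<open>i \<in> I\<close>.  The semigroup generated by
  \<open>c 0, \<dots>, c (k - 1)\<close> (repetitions allowed) is \<open>generated {..<k} c\<close>; the one generated
  by a finite set \<open>A\<close> is \<open>generated A (\<lambda>a. a)\<close>.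
\<close>

definition generated :: "'i set \<Rightarrow> ('i \<Rightarrow> nat) \<Rightarrow> nat set" where
  "generated I g = {\<Sum>i\<in>I. g i * x i | x. True}"

definition minimal_generating_set :: "nat set \<Rightarrow> nat set \<Rightarrow> bool" where
  "minimal_generating_set A S \<longleftrightarrow>
     finite A \<and> generated A (\<lambda>a. a) = S \<and> (\<forall>B. B \<subset> A \<longrightarrow> generated B (\<lambda>a. a) \<noteq> S)"

text \<open>
  Restricting to finite \<open>A\<close> loses nothing, and the minimal generating set is unique:
  see \<open>ex1_minimal_generating_set\<close> below.
\<close>

definition embedding_dim :: "nat set \<Rightarrow> nat" where
  "embedding_dim S = card (THE A. minimal_generating_set A S)"

definition semigroup_quotient :: "nat set \<Rightarrow> nat \<Rightarrow> nat set" where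
  "semigroup_quotient T d = {t. d * t \<in> T}"

definition k_quotient :: "nat \<Rightarrow> nat set \<Rightarrow> bool" where
  "k_quotient k S \<longleftrightarrow>
     (\<exists>d c. d > 0 \<and> (\<forall>i<k. c i > 0) \<and> S = semigroup_quotient (generated {..<k} c) d)"

definition quotient_rank :: "nat set \<Rightarrow> nat" where
  "quotient_rank S = (LEAST k. k_quotient k S)"

definition full_quotient_rank :: "nat set \<Rightarrow> bool" where
  "full_quotient_rank S \<longleftrightarrow> quotient_rank S = embedding_dim S"


lemma numerical_semigroup_mult:
  assumes "numerical_semigroup S" "x \<in> S"
  shows "x * n \<in> S"
  using assms by (induction n) (auto simp: numerical_semigroup_def)

lemma generated_subset:
  assumes "numerical_semigroup S" "finite I" "\<And>i. i \<in> I \<Longrightarrow> g i \<in> S"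
  shows "generated I g \<subseteq> S"
proof -
  have "(\<Sum>i\<in>I. g i * x i) \<in> S" for x
    using assms(2,3)
  proof (induction I rule: finite_induct)
    case empty
    then show ?case using assms(1) by (simp add: numerical_semigroup_def)
  next
    case (insert j J)
    then show ?case
      using assms(1) numerical_semigroup_mult[OF assms(1), of "g j" "x j"]
      by (simp add: numerical_semigroup_def)
  qed
  then show ?thesis by (auto simp: generated_def)
qed

lemma numerical_semigroup_generated: "numerical_semigroup (generated I g)"
  unfolding numerical_semigroup_def
proof (intro conjI ballI)
  show "0 \<in> generated I g"
    unfolding generated_def by (auto intro!: exI[of _ "\<lambda>_. 0"])
next
  fix a b assume "a \<in> generated I g" "b \<in> generated I g"
  then obtain x y where "a = (\<Sum>i\<in>I. g i * x i)" "b = (\<Sum>i\<in>I. g i * y i)"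
    by (auto simp: generated_def)
  then have "a + b = (\<Sum>i\<in>I. g i * (x i + y i))"
    by (simp add: sum.distrib distrib_left)
  then show "a + b \<in> generated I g"
    unfolding generated_def by (intro CollectI exI conjI TrueI)
qed

lemma generator_mem:
  assumes "finite I" "i \<in> I"
  shows "g i \<in> generated I g"
proof -
  have "(\<Sum>j\<in>I. g j * (if j = i then 1 else 0)) = (\<Sum>j\<in>I. if j = i then g j else 0)"
    by (intro sum.cong) auto
  also have "\<dots> = g i" using assms by simp
  finally have "g i = (\<Sum>j\<in>I. g j * (if j = i then 1 else 0))" by simp
  then show ?thesis unfolding generated_def by (intro CollectI exI conjI TrueI)
qed

lemma finitely_generated:
  assumes S: "numerical_semigroup S"
  shows "\<exists>A. finite A \<and> generated A (\<lambda>a. a) = S"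
proof (cases "S = {0}")
  case True
  then show ?thesis by (intro exI[of _ "{}"]) (simp add: generated_def)
next
  case False
  then obtain m where m: "m \<in> S" "m > 0"
    using S by (auto simp: numerical_semigroup_def)
  define a where "a r = (LEAST s. s \<in> S \<and> s mod m = r)" for r
  define R where "R = (\<lambda>s. s mod m) ` S"
  define A where "A = insert m (a ` R)"
  have "R \<subseteq> {..<m}" using m by (auto simp: R_def)
  then have fin: "finite A" unfolding A_def by (simp add: finite_subset)
  have a: "a (s mod m) \<in> S \<and> a (s mod m) mod m = s mod m" if "s \<in> S" for s
    unfolding a_def by (rule LeastI[of _ s]) (simp add: that)
  have a_le: "a (s mod m) \<le> s" if "s \<in> S" for s
    unfolding a_def by (rule Least_le) (simp add: that)
  have "generated A (\<lambda>a. a) \<subseteq> S"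
    using m a by (intro generated_subset[OF S fin]) (auto simp: A_def R_def)
  moreover have "S \<subseteq> generated A (\<lambda>a. a)"
  proof
    fix s assume s: "s \<in> S"
    have "m dvd s - a (s mod m)"
      using a[OF s] a_le[OF s] by (metis mod_eq_dvd_iff_nat)
    then obtain q where q: "s = a (s mod m) + m * q"
      using a_le[OF s] by (metis dvdE le_add_diff_inverse)
    have G: "numerical_semigroup (generated A (\<lambda>a. a))"
      by (rule numerical_semigroup_generated)
    have "a (s mod m) \<in> generated A (\<lambda>a. a)"
      using generator_mem[OF fin, of "a (s mod m)" "\<lambda>a. a"] s by (auto simp: A_def R_def)
    moreover have "m * q \<in> generated A (\<lambda>a. a)"
      using generator_mem[OF fin, of m "\<lambda>a. a"]
      by (intro numerical_semigroup_mult[OF G]) (auto simp: A_def)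
    ultimately show "s \<in> generated A (\<lambda>a. a)"
      using G q by (metis numerical_semigroup_def)
  qed
  ultimately show ?thesis using fin by blast
qed

lemma minimal_generating_set_subset:
  assumes A: "minimal_generating_set A S" and B: "finite B" "generated B (\<lambda>a. a) = S"
  shows "A \<subseteq> B"
proof
  fix a assume aA: "a \<in> A"
  have fin: "finite A" and gen: "generated A (\<lambda>a. a) = S"
    using A by (auto simp: minimal_generating_set_def)
  have S: "numerical_semigroup S" using gen numerical_semigroup_generated by blast
  let ?G = "generated (A - {a}) (\<lambda>a. a)"
  have G: "numerical_semigroup ?G" by (rule numerical_semigroup_generated)
  have aG: "a \<notin> ?G"
  proof
    assume "a \<in> ?G"
    then have "A - {a} \<subset> A" "S \<subseteq> ?G"
      using generated_subset[OF G fin, of "\<lambda>a. a"]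
        generator_mem[of "A - {a}" _ "\<lambda>a. a"] fin aA gen by auto
    moreover have "?G \<subseteq> S"
      using generator_mem[OF fin, of _ "\<lambda>a. a"] fin gen
      by (intro generated_subset[OF S]) auto
    ultimately show False using A by (auto simp: minimal_generating_set_def)
  qed
  have small: "s \<in> ?G" if "s \<in> S" "s < a" for s
  proof -
    obtain x where x: "s = (\<Sum>b\<in>A. b * x b)" using \<open>s \<in> S\<close> gen by (auto simp: generated_def)
    have "s = a * x a + (\<Sum>b\<in>A - {a}. b * x b)"
      using x sum.remove[OF fin aA] by simp
    moreover from this have "x a = 0" using \<open>s < a\<close> by (cases "x a") auto
    ultimately show ?thesis by (auto simp: generated_def)
  qed
  obtain y where y: "a = (\<Sum>b\<in>B. b * y b)"
    using generator_mem[OF fin aA, of "\<lambda>a. a"] gen B by (auto simp: generated_def)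
  show "a \<in> B"
  proof (rule ccontr)
    assume "a \<notin> B"
    have "b * y b \<in> ?G" if b: "b \<in> B" for b
    proof (cases "y b = 0")
      case True
      then show ?thesis using G by (simp add: numerical_semigroup_def)
    next
      case False
      have "b * y b \<le> a" using y B(1) b by (metis member_le_sum zero_le)
      moreover have "b \<le> b * y b" using False by simp
      ultimately have "b < a" using \<open>a \<notin> B\<close> b by (metis le_trans le_neq_implies_less)
      moreover have "b \<in> S" using generator_mem[OF B(1) b, of "\<lambda>a. a"] B by simp
      ultimately show ?thesis using small numerical_semigroup_mult[OF G] by blast
    qed
    then have "generated B (\<lambda>b. b * y b) \<subseteq> ?G" by (intro generated_subset[OF G B(1)])
    moreover have "a \<in> generated B (\<lambda>b. b * y b)"
      unfolding generated_def using y by (auto intro!: exI[of _ "\<lambda>_. 1"])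
    ultimately show False using aG by blast
  qed
qed

lemma ex1_minimal_generating_set:
  assumes S: "numerical_semigroup S"
  shows "\<exists>!A. minimal_generating_set A S"
proof -
  let ?P = "\<lambda>A. finite A \<and> generated A (\<lambda>a. a) = S"
  obtain A where A: "?P A" "\<And>B. ?P B \<Longrightarrow> card A \<le> card B"
    using finitely_generated[OF S] ex_has_least_nat[of ?P _ card] by metis
  have "minimal_generating_set A S"
    unfolding minimal_generating_set_def
  proof (intro conjI allI impI notI)
    fix B assume "B \<subset> A" "generated B (\<lambda>a. a) = S"
    moreover from this have "finite B" "card B < card A"
      using A(1) by (auto intro: finite_subset psubset_card_mono)
    ultimately show False using A(2)[of B] by simp
  qed (use A(1) in auto)
  moreover have "B = C" if "minimal_generating_set B S" "minimal_generating_set C S" for B C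
    using minimal_generating_set_subset[OF that(1), of C]
      minimal_generating_set_subset[OF that(2), of B] that
    unfolding minimal_generating_set_def by blast
  ultimately show ?thesis by blast
qed

text \<open>
  A numerical semigroup \<open>S \<noteq> {0}\<close> with least positive element \<open>m \<le> 2\<close> is not an
  \<open>(m - 1)\<close>-quotient, except for \<open>S = {0, 2, 4, \<dots>}\<close>: a \<open>0\<close>-quotient is \<open>{0}\<close>, and a
  \<open>1\<close>-quotient is the set of multiples of a single number.
\<close>

lemma pred_quotient_imp:
  assumes m: "m = (LEAST x. x \<in> S - {0})" and ne: "S - {0} \<noteq> {}"
    and q: "k_quotient (m - 1) S"
  shows "m \<ge> 3 \<or> S = {n. even n}"
proof (cases "m \<ge> 3")
  case False
  obtain z where "z \<in> S - {0}" using ne by blast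
  then have "m \<in> S - {0}" unfolding m by (rule LeastI)
  then have mS: "m \<in> S" "m > 0" by auto
  obtain d c where dc: "d > 0" "S = semigroup_quotient (generated {..<m - 1} c) d"
    using q by (auto simp: k_quotient_def)
  have "m \<noteq> 1"
    using dc mS by (auto simp: semigroup_quotient_def generated_def)
  then have m2: "m = 2" using False mS by linarith
  have S: "S = {t. c 0 dvd d * t}"
    using dc m2 by (auto simp: semigroup_quotient_def generated_def dvd_def)
  have "1 \<notin> S" using not_less_Least[of 1 "\<lambda>x. x \<in> S - {0}"] m m2 by auto
  have two: "c 0 dvd d * 2" using mS m2 S by simp
  have ev: "c 0 dvd d * (2 * k)" for k
    using two by (metis dvd_mult2 mult.assoc)
  have "n \<in> S \<longleftrightarrow> even n" for n
  proof
    assume n: "n \<in> S"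
    show "even n"
    proof (rule ccontr)
      assume "odd n"
      then obtain k where "n = 2 * k + 1" by (blast elim: oddE)
      then have "c 0 dvd d * (2 * k) + d" using n S by (simp add: algebra_simps)
      then have "c 0 dvd d" using ev[of k] dvd_add_right_iff by blast
      then show False using \<open>1 \<notin> S\<close> S by simp
    qed
  next
    assume "even n"
    then show "n \<in> S" using ev S by auto
  qed
  then show ?thesis by blast
qed simp

end

theory Submission
  imports Defs
begin

text \<open>
  Let \<open>a\<^sub>i\<close> be the least element of \<open>S\<close> congruent to \<open>i\<close> modulo \<open>m\<close>. If some residue class
  is missed, then \<open>m\<close> and the nonzero \<open>a\<^sub>i\<close> are already at most \<open>m - 1\<close> generators.
  Otherwise put \<open>a = a\<^sub>1\<close>, \<open>b = a\<^sub>m\<^sub>-\<^sub>1\<close> and \<open>a + b = m N\<close>. The semigroup generated by \<open>m, a, b\<close>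
  consists of the \<open>t\<close> for which some integer \<open>y\<close> satisfies \<open>(a - 1)/(m a) \<le> y/t \<le> (b + 1)/(m b)\<close>.
  Enlarging the right end of this interval slightly makes it the quotient
  of two generators, \<open>K b - m\<close> and \<open>a\<close>, by \<open>d = K N - 1\<close>; the elements gained in this way are at
  least \<open>K b - m\<close>, so they lie in \<open>S\<close> for large \<open>K\<close>. The other \<open>a\<^sub>i\<close> are added as the generators
  \<open>d a\<^sub>i\<close>, whose multiples do not interfere with divisibility by \<open>d\<close>.
\<close>

section \<open>Quotients of semigroups with two generators\<close>

lemma numerical_semigroup_add:
  "numerical_semigroup S \<Longrightarrow> x \<in> S \<Longrightarrow> y \<in> S \<Longrightarrow> x + y \<in> S"
  by (simp add: numerical_semigroup_def)

lemma numerical_semigroup_quotient: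
  assumes "numerical_semigroup T"
  shows "numerical_semigroup (semigroup_quotient T d)"
proof -
  have "d * (x + y) \<in> T" if "d * x \<in> T" "d * y \<in> T" for x y
    using numerical_semigroup_add[OF assms that] by (simp add: distrib_left)
  moreover have "0 \<in> T" using assms by (simp add: numerical_semigroup_def)
  ultimately show ?thesis
    unfolding numerical_semigroup_def semigroup_quotient_def mem_Collect_eq Ball_def by simp
qed

text \<open>By \<open>c + K * a = d * m\<close>, one \<open>c\<close> and \<open>K\<close> copies of
  \<open>a\<close> can be traded for \<open>d\<close> copies of \<open>m\<close>. Trading all
  \<open>x\<close> copies of \<open>c\<close> leaves a surplus or deficit of \<open>a\<close>, a
  multiple \<open>d * q\<close> by coprimality. A deficit is repaired with
  \<open>a = m * n - b\<close> if \<open>n * q \<le> x\<close>; otherwise \<open>t\<close> is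
  large.\<close>

lemma two_generator_quotient_cases:
  fixes a b c d m n K t x y :: nat
  assumes sum: "a + b = m * n" and d: "d + 1 = K * n" and c: "c + m = K * b"
    and cop: "coprime a d" and pos: "d > 0" "K > 0"
    and t: "d * t = c * x + a * y"
  obtains p q where "t = m * p + a * q" | p q where "t = m * p + b * q" | "t \<ge> c"
proof -
  have "c + K * a + m = K * (m * n)"
    using c sum by (metis add.assoc add.commute distrib_left)
  also have "\<dots> = d * m + m" using d by (metis add_mult_distrib mult.assoc mult.commute nat_mult_1)
  finally have dm: "c + K * a = d * m" by simp
  show thesis
  proof (cases "K * x \<le> y")
    case True
    then obtain z where y: "y = K * x + z" using le_Suc_ex by blast
    have eq: "d * t = d * (m * x) + a * z"
    proof -
      have "d * t = (c + K * a) * x + a * z" using t y by (simp add: algebra_simps)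
      then show ?thesis using dm by simp
    qed
    then have "d dvd a * z" by (metis dvd_add_right_iff dvd_triv_left)
    then have "d dvd z" using cop by (simp add: coprime_commute coprime_dvd_mult_right_iff)
    then obtain q where "z = d * q" by blast
    with eq have "d * t = d * (m * x + a * q)" by (simp add: algebra_simps)
    then have "t = m * x + a * q" using pos by simp
    then show ?thesis using that(1) by blast
  next
    case False
    then obtain z where Kx: "K * x = y + z" by (metis le_Suc_ex nat_le_linear)
    have eq: "d * t + a * z = d * (m * x)"
    proof -
      have "d * t + a * z = c * x + a * (K * x)" using t Kx by (simp add: algebra_simps)
      also have "\<dots> = (c + K * a) * x" by (simp add: algebra_simps)
      finally show ?thesis using dm by simp
    qed
    then have "d dvd a * z" by (metis dvd_add_right_iff dvd_triv_left)
    then have "d dvd z" using cop by (simp add: coprime_commute coprime_dvd_mult_right_iff)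
    then obtain q where q: "z = d * q" by blast
    with eq have "d * (t + a * q) = d * (m * x)" by (simp add: algebra_simps)
    then have tq: "t + a * q = m * x" using pos by simp
    have "K * x + q \<ge> (d + 1) * q" using Kx q by simp
    then have Kxq: "K * x + q \<ge> K * (n * q)" using d by (metis mult.assoc)
    have mnq: "m * (n * q) = a * q + b * q"
      using sum by (metis distrib_right mult.assoc)
    \<comment> \<open>For \<open>q < K\<close> the error \<open>q\<close> in \<open>Kxq\<close>
      vanishes on dividing by \<open>K\<close>, so \<open>n * q \<le> x\<close>. For larger
      \<open>q\<close>, multiplying by \<open>m\<close> gives \<open>c * q \<le> K * t\<close>,
      hence \<open>c \<le> t\<close>.\<close>
    show ?thesis
    proof (cases "q < K")
      case True
      have "K * (n * q) < K * (x + 1)" using Kxq True by simp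
      then have "n * q < x + 1" by (simp only: mult_less_cancel1)
      then have "n * q \<le> x" by simp
      then obtain p where "x = n * q + p" using le_Suc_ex by blast
      then have "t = m * p + b * q" using tq mnq by (simp add: distrib_left)
      then show ?thesis using that(2) by blast
    next
      case False
      have "K * (a * q) + K * (b * q) = m * (K * (n * q))"
        using mnq by (metis distrib_left mult.left_commute)
      also have "\<dots> \<le> m * (K * x + q)" using Kxq by simp
      also have "\<dots> = K * (m * x) + m * q" by (simp add: algebra_simps)
      also have "\<dots> = K * t + K * (a * q) + m * q" using tq by (metis distrib_left)
      finally have "K * (b * q) \<le> K * t + m * q" by simp
      then have "(c + m) * q \<le> K * t + m * q" using c by (simp add: mult.assoc)
      then have "c * q \<le> K * t" by (simp add: distrib_right)
      moreover have "c * K \<le> c * q" using False by simp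
      ultimately have "K * c \<le> K * t" by (metis le_trans mult.commute)
      then show ?thesis using that(3) pos by simp
    qed
  qed
qed

section \<open>Least elements of residue classes\<close>

text \<open>The \<open>LEAST\<close> is junk when \<open>S\<close> misses the residue class of \<open>r\<close>.\<close>

definition apery :: "nat set \<Rightarrow> nat \<Rightarrow> nat \<Rightarrow> nat" where
  "apery S m r = (LEAST s. s \<in> S \<and> s mod m = r)"

lemma apery:
  assumes "s \<in> S"
  shows "apery S m (s mod m) \<in> S" "apery S m (s mod m) mod m = s mod m"
    "apery S m (s mod m) \<le> s"
proof -
  have "apery S m (s mod m) \<in> S \<and> apery S m (s mod m) mod m = s mod m"
    unfolding apery_def by (rule LeastI[of _ s]) (simp add: assms)
  then show "apery S m (s mod m) \<in> S" "apery S m (s mod m) mod m = s mod m" by auto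
  show "apery S m (s mod m) \<le> s"
    unfolding apery_def by (rule Least_le) (simp add: assms)
qed

lemma mem_if_congruent:
  assumes "numerical_semigroup G" "m \<in> G" "u \<in> G" "u \<le> s" "u mod m = s mod m"
  shows "s \<in> G"
proof -
  obtain q where "s = u + m * q"
    using assms(4,5) by (metis dvdE le_add_diff_inverse mod_eq_dvd_iff_nat)
  then show ?thesis
    using assms by (simp add: numerical_semigroup_add numerical_semigroup_mult)
qed

text \<open>Each \<open>s\<close> is \<open>apery S m (s mod m)\<close> plus a multiple of
  \<open>m\<close>; in class 0, multiples of \<open>m\<close> suffice.\<close>

lemma subset_if_apery:
  assumes G: "numerical_semigroup G" "m \<in> G"
    and ap: "\<And>r. r \<in> (\<lambda>s. s mod m) ` S - {0} \<Longrightarrow> apery S m r \<in> G"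
  shows "S \<subseteq> G"
proof
  fix s assume s: "s \<in> S"
  show "s \<in> G"
  proof (cases "s mod m = 0")
    case True
    then obtain q where "s = m * q" by blast
    then show ?thesis using numerical_semigroup_mult[OF G, of q] by simp
  next
    case False
    then have "s mod m \<in> (\<lambda>s. s mod m) ` S - {0}" using s by simp
    then show ?thesis by (rule mem_if_congruent[OF G ap apery(3,2)[OF s]])
  qed
qed

section \<open>Few generators when a residue class is missed\<close>

lemma k_quotient_if_finite_generating:
  assumes S: "numerical_semigroup S"
    and B: "finite B" "B \<noteq> {}" "0 \<notin> B" "B \<subseteq> S" "card B \<le> k"
    and gen: "\<And>G. numerical_semigroup G \<Longrightarrow> B \<subseteq> G \<Longrightarrow> S \<subseteq> G"
  shows "k_quotient k S"
proof -
  obtain f where f: "bij_betw f {0..<card B} B" using ex_bij_betw_nat_finite[OF B(1)] by blast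
  obtain b where b: "b \<in> B" using B(2) by blast
  \<comment> \<open>\<open>B\<close> may have fewer than \<open>k\<close> elements; \<open>b\<close>
    is repeated to fill the list.\<close>
  define c where "c i = (if i < card B then f i else b)" for i
  have cB: "c i \<in> B" for i using f b by (auto simp: c_def bij_betw_def)
  have "B \<subseteq> generated {..<k} c"
  proof
    fix u assume "u \<in> B"
    then obtain i where "i < card B" "u = f i" using f
      by (metis atLeastLessThan_iff bij_betw_imp_surj_on imageE)
    then show "u \<in> generated {..<k} c"
      using generator_mem[of "{..<k}" i c] B(5) by (simp add: c_def)
  qed
  then have "S \<subseteq> generated {..<k} c" by (intro gen numerical_semigroup_generated)
  moreover have "generated {..<k} c \<subseteq> S" using cB B(4) by (intro generated_subset[OF S]) auto
  ultimately have "S = semigroup_quotient (generated {..<k} c) 1"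
    by (auto simp: semigroup_quotient_def)
  moreover have "c i > 0" for i using cB[of i] B(3) by (cases "c i") auto
  ultimately show ?thesis unfolding k_quotient_def by (intro exI[of _ 1] exI[of _ c]) simp
qed

lemma k_quotient_if_residues_missing:
  assumes S: "numerical_semigroup S" and m: "m \<in> S" "m > 0"
    and R: "(\<lambda>s. s mod m) ` S \<noteq> {..<m}"
  shows "k_quotient (m - 1) S"
proof -
  define R where "R = (\<lambda>s. s mod m) ` S"
  \<comment> \<open>\<open>m\<close> replaces \<open>apery S m 0\<close>, which is 0 and so not a
    permitted generator.\<close>
  define B where "B = insert m (apery S m ` (R - {0}))"
  have R_sub: "R \<subset> {..<m}" using m R by (auto simp: R_def)
  have finR: "finite R" using R_sub finite_subset by blast
  have "0 \<in> R" using m by (force simp: R_def)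
  have "card R < m" using psubset_card_mono[OF _ R_sub] by simp
  have "card B \<le> Suc (card (apery S m ` (R - {0})))" using finR by (simp add: B_def card_insert_if)
  also have "\<dots> \<le> Suc (card (R - {0}))" using finR by (simp add: card_image_le)
  also have "\<dots> = card R" using finR \<open>0 \<in> R\<close> by (rule card_Suc_Diff1)
  finally have "card B \<le> m - 1" using \<open>card R < m\<close> by simp
  moreover have "0 \<notin> B"
  proof
    assume "0 \<in> B"
    then have "0 \<in> apery S m ` (R - {0})" using m by (simp add: B_def)
    then obtain r where r: "r \<in> R" "r \<noteq> 0" "apery S m r = 0" by (metis DiffE imageE singletonI)
    then obtain s where "s \<in> S" "r = s mod m" by (auto simp: R_def)
    then show False using apery(2)[of s S m] r by simp
  qed
  moreover have "B \<subseteq> S" using m apery(1) by (auto simp: B_def R_def)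
  moreover have "S \<subseteq> G" if "numerical_semigroup G" "B \<subseteq> G" for G
    using that by (intro subset_if_apery[of G m S]) (auto simp: B_def R_def)
  moreover have "finite B" "B \<noteq> {}" using finR by (auto simp: B_def)
  ultimately show ?thesis by (intro k_quotient_if_finite_generating[OF S, of B])
qed

section \<open>Saving one generator when all residue classes occur\<close>

lemma k_quotient_if_all_residues:
  assumes S: "numerical_semigroup S" and m: "m \<in> S" "m \<ge> 3"
    and min: "\<And>s. s \<in> S \<Longrightarrow> s > 0 \<Longrightarrow> m \<le> s"
    and R: "(\<lambda>s. s mod m) ` S = {..<m}"
  shows "k_quotient (m - 1) S"
proof -
  let ?A = "apery S m"
  have A: "?A r \<in> S" "?A r mod m = r" if "r < m" for r
  proof -
    have "r \<in> (\<lambda>s. s mod m) ` S" unfolding R using that by simp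
    then obtain s where s: "s \<in> S" "r = s mod m" by (rule imageE)
    show "?A r \<in> S" "?A r mod m = r" unfolding s(2) by (rule apery[OF s(1)])+
  qed
  \<comment> \<open>A crude bound for every \<open>?A r\<close>, beyond which \<open>S\<close> has
    no gaps.\<close>
  define F where "F = (\<Sum>r<m. ?A r)"
  have large: "s \<in> S" if "s \<ge> F" for s
  proof -
    have r: "s mod m < m" using m by simp
    then have "?A (s mod m) \<le> F" unfolding F_def by (intro member_le_sum) auto
    then show ?thesis using mem_if_congruent[OF S m(1), of "?A (s mod m)" s] A[OF r] that by simp
  qed
  define a where "a = ?A 1"
  define b where "b = ?A (m - 1)"
  have a: "a \<in> S" "a mod m = 1" using A[of 1] m by (auto simp: a_def)
  have b: "b \<in> S" "b mod m = m - 1" using A[of "m - 1"] m by (auto simp: b_def)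
  have "a > 0" using a(2) by (cases a) auto
  have "b \<noteq> 0" using b(2) m by (cases b) auto
  then have "m \<le> b" using min b by blast
  have "(a + b) mod m = (a mod m + b mod m) mod m" by (simp add: mod_add_eq)
  also have "\<dots> = 0" using a b m by simp
  finally obtain n where n: "a + b = m * n" by (auto elim: dvdE)
  have "n > 0" using n \<open>a > 0\<close> by (cases n) auto
  \<comment> \<open>The factor \<open>a\<close> makes \<open>d\<close> congruent to -1 modulo
    \<open>a\<close>, hence coprime to it. The factor \<open>F + 2\<close> makes \<open>d\<close>
    positive and \<open>e\<close> larger than \<open>F\<close>.\<close>
  define K where "K = a * (F + 2)"
  have K: "K \<ge> F + 2" using \<open>a > 0\<close> unfolding K_def by (cases a) simp_all
  define d where "d = K * n - 1"
  define e where "e = K * b - m"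
  have "K \<le> K * n" using \<open>n > 0\<close> by (cases n) simp_all
  then have d: "d + 1 = K * n" "d > 0" using K unfolding d_def by linarith+
  have "K * b = (K - 1) * b + b" using K by (cases K) auto
  moreover have "K - 1 \<le> (K - 1) * b" using \<open>b \<noteq> 0\<close> by (cases b) simp_all
  ultimately have e: "e + m = K * b" "e \<ge> K - 1" using \<open>m \<le> b\<close> unfolding e_def by linarith+
  have "coprime a d"
  proof (rule coprimeI)
    fix x assume "x dvd a" "x dvd d"
    moreover have "x dvd d + 1" using \<open>x dvd a\<close> d(1) by (simp add: K_def)
    ultimately show "is_unit x" by (metis dvd_add_right_iff)
  qed
  note two_gen = two_generator_quotient_cases[OF n d(1) e(1) this d(2)]
  \<comment> \<open>Slots 0 and 1 go to the two-generator quotient, which recovers both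
    \<open>m\<close> and \<open>?A (m - 1)\<close>. Classes 2 to \<open>m - 2\<close> fill the rest,
    \<open>m - 1\<close> slots in all.\<close>
  define c where "c i = (if i = 0 then e else if i = 1 then a else d * ?A i)" for i
  define Q where "Q = semigroup_quotient (generated {..<m - 1} c) d"
  have T: "numerical_semigroup (generated {..<m - 1} c)" by (rule numerical_semigroup_generated)
  have Q: "numerical_semigroup Q" unfolding Q_def by (intro numerical_semigroup_quotient T)
  have c_mem: "c i * x \<in> generated {..<m - 1} c" if "i < m - 1" for i x
    using generator_mem[of "{..<m - 1}" i c] that by (intro numerical_semigroup_mult[OF T]) simp
  have e_mem: "e * x \<in> generated {..<m - 1} c" for x using c_mem[of 0 x] m by (simp add: c_def)
  have a_mem: "a * x \<in> generated {..<m - 1} c" for x using c_mem[of 1 x] m by (simp add: c_def)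
  \<comment> \<open>The omitted generators return through \<open>d * m = e + K * a\<close> and
    \<open>d * b = n * e + a\<close>.\<close>
  have "d * m + m = K * n * m" using d(1) by (metis add_mult_distrib nat_mult_1)
  also have "\<dots> = K * a + K * b" using n by (metis distrib_left mult.assoc mult.commute)
  finally have "d * m = e * 1 + a * K" using e(1) by (simp add: mult.commute)
  then have "m \<in> Q"
    using numerical_semigroup_add[OF T e_mem[of 1] a_mem[of K]]
    by (simp add: Q_def semigroup_quotient_def)
  have "d * b + b = n * (K * b)" using d(1) by (metis add_mult_distrib nat_mult_1 mult.assoc mult.commute)
  also have "\<dots> = n * e + (a + b)" using n e(1) by (metis distrib_left mult.commute)
  finally have "d * b = e * n + a * 1" by (simp add: mult.commute)
  then have "b \<in> Q"
    using numerical_semigroup_add[OF T e_mem[of n] a_mem[of 1]]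
    by (simp add: Q_def semigroup_quotient_def)
  have "?A r \<in> Q" if r: "r < m" "r \<noteq> 0" for r
  proof -
    consider "r = 1" | "r = m - 1" | "r < m - 1" "r \<noteq> 1" using r by linarith
    then show ?thesis
    proof cases
      case 1
      then show ?thesis
        using a_mem[of d] by (simp add: Q_def semigroup_quotient_def a_def mult.commute)
    next
      case 2
      then show ?thesis using \<open>b \<in> Q\<close> by (simp add: b_def)
    next
      case 3
      then show ?thesis
        using c_mem[of r 1] r by (simp add: Q_def semigroup_quotient_def c_def)
    qed
  qed
  then have "S \<subseteq> Q" using R by (intro subset_if_apery[OF Q \<open>m \<in> Q\<close>]) auto
  moreover have "Q \<subseteq> S"
  proof
    fix t assume "t \<in> Q"
    then obtain x where x: "d * t = (\<Sum>i<m - 1. c i * x i)"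
      by (auto simp: Q_def semigroup_quotient_def generated_def)
    \<comment> \<open>The scaled generators contribute \<open>d * u\<close>, so
      \<open>v = t - u\<close> lies in the quotient by \<open>d\<close> of the semigroup of
      \<open>e\<close> and \<open>a\<close> alone.\<close>
    define u where "u = (\<Sum>i=2..<m - 1. ?A i * x i)"
    have split: "{..<m - 1} = insert 0 (insert 1 {2..<m - 1})" using m by auto
    have "(\<Sum>i=2..<m - 1. c i * x i) = d * u"
      unfolding u_def sum_distrib_left by (intro sum.cong) (auto simp: c_def)
    then have dt: "d * t = e * x 0 + a * x 1 + d * u"
      using x unfolding split by (simp add: c_def)
    then have "u \<le> t" using d(2) by (metis le_add2 mult_le_cancel1)
    then obtain v where v: "t = u + v" using le_Suc_ex by blast
    then have dv: "d * v = e * x 0 + a * x 1" using dt by (simp add: distrib_left)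
    have "K > 0" using K by simp
    have "v \<in> S"
    proof (rule two_gen[OF \<open>K > 0\<close> dv])
      show "v \<in> S" if "v = m * p + a * q" for p q
        using that S m a by (simp add: numerical_semigroup_add numerical_semigroup_mult)
      show "v \<in> S" if "v = m * p + b * q" for p q
        using that S m b by (simp add: numerical_semigroup_add numerical_semigroup_mult)
      show "v \<in> S" if "v \<ge> e" using that e(2) K by (intro large) linarith
    qed
    moreover have "u \<in> S"
    proof -
      have "u \<in> generated {2..<m - 1} ?A" by (auto simp: u_def generated_def)
      moreover have "generated {2..<m - 1} ?A \<subseteq> S" using A by (intro generated_subset[OF S]) auto
      ultimately show ?thesis by blast
    qed
    ultimately show "t \<in> S" using v numerical_semigroup_add[OF S] by simp
  qed
  ultimately have "S = Q" by blast
  moreover have "c i > 0" if "i < m - 1" for i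
  proof -
    have "i < m" using that by simp
    then have "?A i > 0" if "i \<noteq> 0" using A(2)[of i] that by (cases "?A i") simp_all
    then show ?thesis using d(2) e(2) K \<open>a > 0\<close> by (auto simp: c_def)
  qed
  ultimately show ?thesis unfolding k_quotient_def Q_def using d(2) by blast
qed

theorem theorem4p5:
  fixes S :: "nat set" and m :: nat
  assumes "numerical_semigroup S"
    and "S \<noteq> {0}"
    and "m = (LEAST x. x \<in> S - {0})"
    and "m \<ge> 3 \<or> S = {n. even n}"
  shows "k_quotient (m - 1) S \<and> (embedding_dim S = m \<longrightarrow> \<not> full_quotient_rank S)"
proof -
  obtain z where "z \<in> S - {0}" using assms(1,2) by (auto simp: numerical_semigroup_def)
  then have "m \<in> S - {0}" unfolding assms(3) by (rule LeastI)
  then have m: "m \<in> S" "m > 0" by auto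
  have min: "m \<le> s" if "s \<in> S" "s > 0" for s
    unfolding assms(3) by (rule Least_le) (use that in auto)
  have "k_quotient (m - 1) S"
  proof (cases "(\<lambda>s. s mod m) ` S = {..<m}")
    case True
    \<comment> \<open>The even numbers have \<open>m = 2\<close> and miss residue 1.\<close>
    have "m \<ge> 3"
    proof (rule ccontr)
      assume "\<not> m \<ge> 3"
      then have S: "S = {n. even n}" using assms(4) by blast
      then have "m = 2" using min[of 2] m by (auto elim!: evenE)
      then have "1 \<in> (\<lambda>s. s mod 2) ` S" using True by auto
      then show False using S by auto
    qed
    then show ?thesis using k_quotient_if_all_residues assms(1) m min True by blast
  next
    case False
    then show ?thesis using k_quotient_if_residues_missing assms(1) m by blast
  qed
  moreover from this have "quotient_rank S \<le> m - 1"
    unfolding quotient_rank_def by (rule Least_le)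
  ultimately show ?thesis using m by (auto simp: full_quotient_rank_def)
qed

end
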